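(* Let $k\ge 3$ and $e\ge 3$. If there exists a strongly equitable $k$-chromatic $e$-star system of order $n_0\equiv 0\pmod{2e}$, then there exists, for some $n\equiv 0\pmod{2e}$, a strongly equitable uniquely $k$-chromatic $e$-star system of order $n$.
   Context: An $e$-star is the complete bipartite graph $K_{1,e}$. An $e$-star system of order $n$ is a pair $(V,\mathcal B)$ where $|V|=n$ and $\mathcal B$ is a set of $e$-stars (subgraphs of the complete graph $K_n$ on $V$) whose edge sets partition the edge set of $K_n$. An $e$-star system is $k$-colourable if $V$ can be partitioned into $k$ sets (colour classes) such that no star in $\mathcal B$ has all its vertices in the same class; it is $k$-chromatic if it is $k$-colourable but not $(k-1)$-colourable. It is uniquely $k$-colourable if any two $k$-colourings differ only by a permutation of the colours. A colouring is strongly equitable if all colour classes have the same size. A strongly equitable (uniquely) $k$-chromatic system is a (uniquely colourable) $k$-chromatic system admitting a strongly equitable $k$-colouring. *)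

theory Defs
  imports "HOL-Number_Theory.Cong" "HOL-Combinatorics.Permutations"
begin

text \<open>A graph is a pair of a vertex set and a set of edges, each edge being a two-element set.\<close>

type_synonym 'a graph = "'a set \<times> 'a set set"

abbreviation verts :: "'a graph \<Rightarrow> 'a set" where
  "verts G \<equiv> fst G"

abbreviation edges :: "'a graph \<Rightarrow> 'a set set" where
  "edges G \<equiv> snd G"

definition complete_graph :: "'a set \<Rightarrow> 'a graph" where
  "complete_graph V = (V, {{x, y} | x y. x \<in> V \<and> y \<in> V \<and> x \<noteq> y})"

definition subgraph :: "'a graph \<Rightarrow> 'a graph \<Rightarrow> bool" where
  "subgraph H G \<longleftrightarrow> verts H \<subseteq> verts G \<and> edges H \<subseteq> edges G"

definition is_star :: "nat \<Rightarrow> 'a graph \<Rightarrow> bool" where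
  "is_star e S \<longleftrightarrow>
     (\<exists>c L. finite L \<and> card L = e \<and> c \<notin> L \<and> S = (insert c L, {{c, x} | x. x \<in> L}))"

definition star_system :: "nat \<Rightarrow> nat \<Rightarrow> 'a set \<Rightarrow> 'a graph set \<Rightarrow> bool" where
  "star_system e n V B \<longleftrightarrow>
     finite V \<and> card V = n \<and>
     (\<forall>S\<in>B. is_star e S \<and> subgraph S (complete_graph V)) \<and>
     pairwise (\<lambda>S T. disjnt (edges S) (edges T)) B \<and>
     (\<Union>S\<in>B. edges S) = edges (complete_graph V)"

definition colour_class :: "'a set \<Rightarrow> ('a \<Rightarrow> nat) \<Rightarrow> nat \<Rightarrow> 'a set" where
  "colour_class V c i = {x \<in> V. c x = i}"

text \<open>A partition of \<open>V\<close> into \<open>k\<close> colour classes is given by a map from \<open>V\<close> to the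
  colours \<open>0, \<dots>, k - 1\<close>. Classes may be empty. For \<open>k\<close>-chromatic systems of stars with at least
  one edge this makes no difference: a \<open>k\<close>-colouring with an empty class is a
  \<open>(k - 1)\<close>-colouring, and an empty class can be filled by splitting a class with at least two
  vertices.\<close>

definition colouring :: "nat \<Rightarrow> 'a set \<Rightarrow> 'a graph set \<Rightarrow> ('a \<Rightarrow> nat) \<Rightarrow> bool" where
  "colouring k V B c \<longleftrightarrow>
     c ` V \<subseteq> {..<k} \<and> (\<forall>S\<in>B. \<not> (\<exists>i<k. verts S \<subseteq> colour_class V c i))"

definition colourable :: "nat \<Rightarrow> 'a set \<Rightarrow> 'a graph set \<Rightarrow> bool" where
  "colourable k V B \<longleftrightarrow> (\<exists>c. colouring k V B c)"

definition chromatic :: "nat \<Rightarrow> 'a set \<Rightarrow> 'a graph set \<Rightarrow> bool" where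
  "chromatic k V B \<longleftrightarrow> colourable k V B \<and> \<not> colourable (k - 1) V B"

definition uniquely_colourable :: "nat \<Rightarrow> 'a set \<Rightarrow> 'a graph set \<Rightarrow> bool" where
  "uniquely_colourable k V B \<longleftrightarrow>
     (\<forall>c d. colouring k V B c \<longrightarrow> colouring k V B d \<longrightarrow>
        (\<exists>p. p permutes {..<k} \<and> (\<forall>x\<in>V. d x = p (c x))))"

definition strongly_equitable :: "nat \<Rightarrow> 'a set \<Rightarrow> ('a \<Rightarrow> nat) \<Rightarrow> bool" where
  "strongly_equitable k V c \<longleftrightarrow>
     (\<forall>i<k. \<forall>j<k. card (colour_class V c i) = card (colour_class V c j))"

definition strongly_equitable_chromatic :: "nat \<Rightarrow> 'a set \<Rightarrow> 'a graph set \<Rightarrow> bool" where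
  "strongly_equitable_chromatic k V B \<longleftrightarrow>
     chromatic k V B \<and> (\<exists>c. colouring k V B c \<and> strongly_equitable k V c)"

definition strongly_equitable_uniquely_chromatic :: "nat \<Rightarrow> 'a set \<Rightarrow> 'a graph set \<Rightarrow> bool" where
  "strongly_equitable_uniquely_chromatic k V B \<longleftrightarrow>
     uniquely_colourable k V B \<and> chromatic k V B \<and>
     (\<exists>c. colouring k V B c \<and> strongly_equitable k V c)"

end

theory Submission
  imports Defs "HOL-Library.Disjoint_Sets" "HOL-Library.FuncSet" "HOL-Library.Nat_Bijection"
begin

text \<open>
  Arrange the vertices in a grid \<open>A \<times> {..<k}\<close> whose columns are the intended colour classes. Two
  grids with disjoint sets of rows can be joined by letting every vertex choose its stars into the
  other grid almost freely: disjoint \<open>e\<close>-sets of leaves outside its own column, as long as they are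
  not too many, extend to a partition of its out-neighbours into \<open>e\<close>-sets not inside its column.

  A star whose \<open>e\<close> leaves all have colour \<open>q\<close> forbids \<open>q\<close> to its centre. Add rows indexed by all
  conceivable colourings of the old grid, and aim the stars of each new row at monochromatic sets of
  the colouring that is its index. The rows indexed by the actual colouring avoid, in each column,
  the colours found so far in the other columns, so the pigeonhole principle yields \<open>e\<close> vertices of
  a new colour in the next column. After \<open>k\<close> rounds one of finitely many known row sets is coloured
  by a permutation of the columns; further rows aimed at all of these sets then always are. Joining
  with one more grid, whose rows look at such forced rows and are looked at by all others, forces
  every vertex.
\<close>

section \<open>Partitions into sets of equal size\<close>

lemma ex_bij_betw_rectangle:
  assumes "finite R" "card R = m * e" "T \<subseteq> R" "card T = m" "e > 0"
  shows "\<exists>g. bij_betw g ({..<m} \<times> {..<e}) R \<and> g ` ({..<m} \<times> {0}) = T"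
proof -
  have "finite T"
    using assms(1,3) by (rule finite_subset[rotated])
  then obtain g\<^sub>0 where g\<^sub>0: "bij_betw g\<^sub>0 ({..<m} \<times> {0::nat}) T"
    using finite_same_card_bij[of "{..<m} \<times> {0::nat}" T] assms(4)
    by (auto simp: card_cartesian_product)
  have "card (R - T) = m * (e - 1)"
    using assms(2-4) \<open>finite T\<close> by (simp add: card_Diff_subset diff_mult_distrib2)
  then obtain g\<^sub>1 where g\<^sub>1: "bij_betw g\<^sub>1 ({..<m} \<times> {1..<e}) (R - T)"
    using finite_same_card_bij[of "{..<m} \<times> {1..<e}" "R - T"] assms(1)
    by (auto simp: card_cartesian_product)
  define g where "g = (\<lambda>x. if x \<in> {..<m} \<times> {0} then g\<^sub>0 x else g\<^sub>1 x)"
  have "bij_betw g ({..<m} \<times> {0} \<union> {..<m} \<times> {1..<e}) (T \<union> (R - T))"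
    unfolding g_def by (rule bij_betw_disjoint_Un[OF g\<^sub>0 g\<^sub>1]) auto
  moreover have "{..<m} \<times> {0} \<union> {..<m} \<times> {1..<e} = {..<m} \<times> {..<e}" "T \<union> (R - T) = R"
    using assms(3,5) by auto
  ultimately have "bij_betw g ({..<m} \<times> {..<e}) R"
    by simp
  moreover have "g ` ({..<m} \<times> {0}) = T"
    using g\<^sub>0 unfolding g_def bij_betw_def by auto
  ultimately show ?thesis by blast
qed

lemma ex_uniform_partition_avoiding:
  assumes "finite R" "e dvd card R" "card R \<le> e * card (R - A)" "e > 0"
  shows "\<exists>Q. partition_on R Q \<and> (\<forall>L\<in>Q. card L = e \<and> \<not> L \<subseteq> A)"
proof -
  obtain m where m: "card R = m * e"
    using assms(2) by (metis dvd_def mult.commute)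
  then have "m \<le> card (R - A)"
    using assms(3,4) by simp
  then obtain T where T: "T \<subseteq> R - A" "card T = m"
    by (meson obtain_subset_with_card_n)
  then obtain g where bij: "bij_betw g ({..<m} \<times> {..<e}) R" and g_T: "g ` ({..<m} \<times> {0}) = T"
    using ex_bij_betw_rectangle[OF assms(1) m _ _ assms(4)] by blast
  have inj: "inj_on g ({..<m} \<times> {..<e})" and image: "g ` ({..<m} \<times> {..<e}) = R"
    using bij unfolding bij_betw_def by auto
  define Q where "Q = (\<lambda>b. g ` ({b} \<times> {..<e})) ` {..<m}"
  have "partition_on R Q"
  proof (rule partition_onI)
    show "\<Union>Q = R"
      unfolding Q_def image[symmetric] by auto
    show "{} \<notin> Q"
      using \<open>e > 0\<close> unfolding Q_def by auto
    show "disjnt L L'" if "L \<in> Q" "L' \<in> Q" "L \<noteq> L'" for L L'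
      using that inj unfolding Q_def disjnt_iff inj_on_def by fastforce
  qed
  moreover have "card L = e \<and> \<not> L \<subseteq> A" if L: "L \<in> Q" for L
  proof -
    obtain b where b: "b < m" "L = g ` ({b} \<times> {..<e})"
      using L by (auto simp: Q_def)
    have "inj_on g ({b} \<times> {..<e})"
      using inj b(1) by (auto intro: inj_on_subset)
    then have "card L = e"
      unfolding b(2) by (simp add: card_image card_cartesian_product)
    moreover have "g (b, 0) \<in> L" "g (b, 0) \<in> T"
      using b \<open>e > 0\<close> g_T by auto
    ultimately show ?thesis
      using T(1) by blast
  qed
  ultimately show ?thesis by blast
qed

lemma ex_uniform_partition_extending:
  assumes "finite R" "e dvd card R" "e \<ge> 2"
    and F: "disjoint F" "\<And>L. L \<in> F \<Longrightarrow> L \<subseteq> R - A \<and> card L = e"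
    and enough: "card (R \<inter> A) \<le> card (R - A - \<Union>F)"
  shows "\<exists>Q. partition_on R Q \<and> F \<subseteq> Q \<and> (\<forall>L\<in>Q. card L = e \<and> \<not> L \<subseteq> A)"
proof -
  let ?R = "R - \<Union>F"
  have F_nonempty: "L \<noteq> {}" if "L \<in> F" for L
    using F(2)[OF that] assms(3) by auto
  have "\<Union>F \<subseteq> R"
    using F(2) by blast
  have part_F: "partition_on (\<Union>F) F"
    using F(1) F_nonempty unfolding partition_on_def by blast
  have "finite (\<Union>F)"
    using \<open>\<Union>F \<subseteq> R\<close> assms(1) by (rule finite_subset)
  then have "finite L" if "L \<in> F" for L
    using that by (meson Union_upper finite_subset)
  then have "card (\<Union>F) = (\<Sum>L\<in>F. card L)"
    by (rule card_Union_disjoint[OF F(1)])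
  then have "card (\<Union>F) = card F * e"
    using F(2) by simp
  then have "e dvd card ?R"
    using assms(2) \<open>\<Union>F \<subseteq> R\<close> \<open>finite (\<Union>F)\<close> by (simp add: card_Diff_subset)
  moreover have "card ?R \<le> e * card (?R - A)"
  proof -
    have "?R - A = R - A - \<Union>F" "?R \<inter> A = R \<inter> A"
      using F(2) by auto
    then have "card ?R \<le> 2 * card (?R - A)"
      using enough assms(1) card_Int_Diff[of ?R A] by simp
    also have "\<dots> \<le> e * card (?R - A)"
      using assms(3) by simp
    finally show ?thesis .
  qed
  ultimately obtain Q where Q: "partition_on ?R Q" "\<forall>L\<in>Q. card L = e \<and> \<not> L \<subseteq> A"
    using ex_uniform_partition_avoiding[of ?R e A] assms(1,3) by auto
  have "partition_on R (F \<union> Q)"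
    using part_F Q(1) \<open>\<Union>F \<subseteq> R\<close> disjoint_union[of F Q] unfolding partition_on_def by auto
  moreover have "\<not> L \<subseteq> A" if "L \<in> F" for L
    using F(2)[OF that] F_nonempty[OF that] by blast
  ultimately show ?thesis
    using F(2) Q(2) by (intro exI[of _ "F \<union> Q"]) blast
qed

section \<open>Star decompositions\<close>

definition star :: "'a \<Rightarrow> 'a set \<Rightarrow> 'a graph" where
  "star v L = (insert v L, (\<lambda>x. {v, x}) ` L)"

lemma verts_star [simp]: "verts (star v L) = insert v L"
  and edges_star [simp]: "edges (star v L) = (\<lambda>x. {v, x}) ` L"
  by (simp_all add: star_def)

lemma is_star_iff: "is_star e S \<longleftrightarrow> (\<exists>v L. finite L \<and> card L = e \<and> v \<notin> L \<and> S = star v L)"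
  unfolding is_star_def star_def Setcompr_eq_image ..

lemma verts_complete_graph [simp]: "verts (complete_graph V) = V"
  by (simp add: complete_graph_def)

lemma edges_complete_graph: "edges (complete_graph V) = {E. E \<subseteq> V \<and> card E = 2}"
  unfolding complete_graph_def card_2_iff by auto

lemma edges_complete_graph_Un:
  assumes "V \<inter> W = {}"
  shows "edges (complete_graph (V \<union> W)) =
    edges (complete_graph V) \<union> edges (complete_graph W) \<union> {{v, w} | v w. v \<in> V \<and> w \<in> W}"
    (is "?E (V \<union> W) = ?E V \<union> ?E W \<union> ?VW")
proof (intro equalityI subsetI)
  show "E \<in> ?E (V \<union> W)" if "E \<in> ?E V \<union> ?E W \<union> ?VW" for E
    using that assms by (auto simp: edges_complete_graph card_insert_if)
  show "E \<in> ?E V \<union> ?E W \<union> ?VW" if "E \<in> ?E (V \<union> W)" for E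
  proof -
    obtain x y where xy: "E = {x, y}" "x \<noteq> y" "x \<in> V \<union> W" "y \<in> V \<union> W"
      using \<open>E \<in> ?E (V \<union> W)\<close> by (auto simp: edges_complete_graph card_2_iff)
    then have "E = {y, x}"
      by (simp add: insert_commute)
    then show ?thesis
      using xy by (auto simp: edges_complete_graph)
  qed
qed

lemma subgraph_complete_graph_iff:
  assumes "is_star e S" "e > 0"
  shows "subgraph S (complete_graph V) \<longleftrightarrow> edges S \<subseteq> edges (complete_graph V)"
proof -
  obtain v L where S: "S = star v L" "card L = e"
    using assms(1) unfolding is_star_iff by blast
  then have "L \<noteq> {}"
    using assms(2) by auto
  then have "verts S = \<Union>(edges S)"
    using S(1) by auto
  moreover have "\<Union>(edges (complete_graph V)) \<subseteq> V"
    by (auto simp: edges_complete_graph)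
  ultimately show ?thesis
    unfolding subgraph_def by auto
qed

definition star_decomposition :: "nat \<Rightarrow> 'a set set \<Rightarrow> 'a graph set \<Rightarrow> bool" where
  "star_decomposition e E B \<longleftrightarrow>
     (\<forall>S\<in>B. is_star e S) \<and> pairwise (\<lambda>S T. disjnt (edges S) (edges T)) B \<and> (\<Union>S\<in>B. edges S) = E"

lemma star_system_iff:
  assumes "e > 0"
  shows "star_system e n V B \<longleftrightarrow>
    finite V \<and> card V = n \<and> star_decomposition e (edges (complete_graph V)) B"
  unfolding star_system_def star_decomposition_def
  using subgraph_complete_graph_iff[OF _ assms, of _ V] by blast

lemma star_decomposition_Un:
  assumes "star_decomposition e E B" "star_decomposition e F C" "E \<inter> F = {}"
  shows "star_decomposition e (E \<union> F) (B \<union> C)"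
proof -
  have "disjnt (edges S) (edges T)" if "S \<in> B" "T \<in> C" for S T
    using that assms unfolding star_decomposition_def disjnt_def by blast
  then have "pairwise (\<lambda>S T. disjnt (edges S) (edges T)) (B \<union> C)"
    using assms(1,2) unfolding star_decomposition_def pairwise_def by (metis UnE disjnt_sym)
  then show ?thesis
    using assms(1,2) unfolding star_decomposition_def by auto
qed

lemma star_decomposition_orientation:
  assumes part: "\<And>v. v \<in> V \<Longrightarrow> partition_on (Out v) (P v)"
    and leaves: "\<And>v L. v \<in> V \<Longrightarrow> L \<in> P v \<Longrightarrow> finite L \<and> card L = e"
    and asym: "\<And>v w. v \<in> V \<Longrightarrow> w \<in> V \<Longrightarrow> w \<in> Out v \<Longrightarrow> v \<notin> Out w"
  shows "star_decomposition e (\<Union>v\<in>V. edges (star v (Out v))) {star v L | v L. v \<in> V \<and> L \<in> P v}"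
proof -
  let ?X = "{star v L | v L. v \<in> V \<and> L \<in> P v}"
  have union: "\<Union>(P v) = Out v" if "v \<in> V" for v
    using part[OF that] unfolding partition_on_def by blast
  have "is_star e (star v L)" if "v \<in> V" "L \<in> P v" for v L
    using leaves[OF that] asym[OF that(1,1)] union[OF that(1)] that(2)
    unfolding is_star_iff by blast
  moreover have "star v L = star v' L'"
    if v: "v \<in> V" "L \<in> P v" and v': "v' \<in> V" "L' \<in> P v'"
      and E: "E \<in> edges (star v L)" "E \<in> edges (star v' L')" for v L v' L' E
  proof -
    obtain x x' where x: "x \<in> L" "E = {v, x}" and x': "x' \<in> L'" "E = {v', x'}"
      using E by auto
    have "x \<in> Out v" "x' \<in> Out v'"
      using union v v' x(1) x'(1) by blast+
    then have "v = v'" "x = x'"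
      using asym v(1) v'(1) x(2) x'(2) by (auto simp: doubleton_eq_iff)
    moreover from this have "L = L'"
      using part[OF v(1)] v(2) v'(2) x(1) x'(1) unfolding partition_on_def disjoint_def by blast
    ultimately show ?thesis by simp
  qed
  then have "pairwise (\<lambda>S T. disjnt (edges S) (edges T)) ?X"
    unfolding pairwise_def disjnt_iff by blast
  moreover have "(\<Union>S\<in>?X. edges S) = (\<Union>v\<in>V. \<Union>L\<in>P v. edges (star v L))"
    by blast
  moreover have "(\<Union>L\<in>P v. edges (star v L)) = edges (star v (Out v))" if "v \<in> V" for v
    unfolding union[OF that, symmetric] by auto
  ultimately show ?thesis
    unfolding star_decomposition_def by auto
qed

lemma star_system_join:
  assumes V: "star_system e n V B" and W: "star_system e m W C" and disj: "V \<inter> W = {}" and "e > 0"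
    and part: "\<And>v. v \<in> V \<union> W \<Longrightarrow> partition_on (Out v) (P v)"
    and leaves: "\<And>v L. v \<in> V \<union> W \<Longrightarrow> L \<in> P v \<Longrightarrow> card L = e"
    and Out_V: "\<And>v. v \<in> V \<Longrightarrow> Out v \<subseteq> W" and Out_W: "\<And>w. w \<in> W \<Longrightarrow> Out w \<subseteq> V"
    and orient: "\<And>v w. v \<in> V \<Longrightarrow> w \<in> W \<Longrightarrow> w \<in> Out v \<longleftrightarrow> v \<notin> Out w"
  shows "star_system e (n + m) (V \<union> W) (B \<union> C \<union> {star v L | v L. v \<in> V \<union> W \<and> L \<in> P v})"
proof -
  let ?E = "\<lambda>V. edges (complete_graph V)" and ?cross = "\<Union>v\<in>V \<union> W. edges (star v (Out v))"
  note V = V[unfolded star_system_iff[OF \<open>e > 0\<close>]] and W = W[unfolded star_system_iff[OF \<open>e > 0\<close>]]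
  have cross: "?cross = {{v, w} | v w. v \<in> V \<and> w \<in> W}" (is "_ = ?VW")
  proof (intro equalityI subsetI)
    show "E \<in> ?VW" if "E \<in> ?cross" for E
      using that Out_V Out_W by (fastforce simp: insert_commute)
    show "E \<in> ?cross" if "E \<in> ?VW" for E
      using that orient by (fastforce simp: insert_commute)
  qed
  have "star_decomposition e (?E V \<union> ?E W) (B \<union> C)"
  proof (rule star_decomposition_Un)
    show "?E V \<inter> ?E W = {}"
    proof -
      have "E \<subseteq> V \<inter> W \<and> card E = 2" if "E \<in> ?E V \<inter> ?E W" for E
        using that by (auto simp: edges_complete_graph)
      then show ?thesis
        using disj by fastforce
    qed
  qed (use V W in auto)
  then have "star_decomposition e (?E V \<union> ?E W \<union> ?cross)
      (B \<union> C \<union> {star v L | v L. v \<in> V \<union> W \<and> L \<in> P v})"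
  proof (rule star_decomposition_Un)
    show "star_decomposition e ?cross {star v L | v L. v \<in> V \<union> W \<and> L \<in> P v}"
    proof (rule star_decomposition_orientation[OF part])
      show "finite L \<and> card L = e" if "v \<in> V \<union> W" "L \<in> P v" for v L
        using leaves[OF that] \<open>e > 0\<close> card_ge_0_finite[of L] by auto
      show "v \<notin> Out w" if "v \<in> V \<union> W" "w \<in> V \<union> W" "w \<in> Out v" for v w
        using that Out_V Out_W orient disj by blast
    qed
    show "(?E V \<union> ?E W) \<inter> ?cross = {}"
      using disj unfolding cross by (auto simp: edges_complete_graph)
  qed
  moreover have "?E V \<union> ?E W \<union> ?cross = ?E (V \<union> W)"
    using edges_complete_graph_Un[OF disj] unfolding cross by simp
  ultimately show ?thesis
    using V W disj unfolding star_system_iff[OF \<open>e > 0\<close>] by (simp add: card_Un_disjoint)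
qed

definition map_graph :: "('a \<Rightarrow> 'b) \<Rightarrow> 'a graph \<Rightarrow> 'b graph" where
  "map_graph f G = (f ` verts G, image f ` edges G)"

lemma verts_map_graph [simp]: "verts (map_graph f G) = f ` verts G"
  and edges_map_graph [simp]: "edges (map_graph f G) = image f ` edges G"
  by (simp_all add: map_graph_def)

lemma map_graph_star: "map_graph f (star v L) = star (f v) (f ` L)"
  by (auto simp: map_graph_def star_def image_image)

lemma edges_map_graph_complete_graph:
  assumes "inj_on f V"
  shows "edges (map_graph f (complete_graph V)) = edges (complete_graph (f ` V))"
proof -
  have "card (f ` E) = card E" if "E \<subseteq> V" for E
    using assms that by (meson card_image inj_on_subset)
  then show ?thesis
    by (auto simp: edges_complete_graph subset_image_iff)
qed

lemma is_star_map_graph: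
  assumes "is_star e S" "inj_on f (verts S)"
  shows "is_star e (map_graph f S)"
proof -
  obtain v L where S: "S = star v L" "finite L" "card L = e" "v \<notin> L"
    using assms(1) unfolding is_star_iff by blast
  then have "card (f ` L) = e" "f v \<notin> f ` L"
    using assms(2) by (auto simp: card_image inj_on_def)
  then show ?thesis
    using S(1,2) unfolding is_star_iff by (auto simp: map_graph_star)
qed

lemma star_decomposition_map_graph:
  assumes "star_decomposition e E B" "inj_on f V" "\<And>S. S \<in> B \<Longrightarrow> verts S \<subseteq> V" "E \<subseteq> Pow V"
  shows "star_decomposition e (image f ` E) (map_graph f ` B)"
proof -
  note B = assms(1)[unfolded star_decomposition_def]
  have inj: "inj_on (image f) E"
    using inj_on_image_Pow[OF assms(2)] assms(4) by (rule inj_on_subset)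
  have "is_star e (map_graph f S)" if "S \<in> B" for S
    using that B assms(2,3) by (blast intro: is_star_map_graph inj_on_subset)
  moreover have "disjnt (image f ` edges S) (image f ` edges T)" if "S \<in> B" "T \<in> B" "S \<noteq> T" for S T
  proof -
    have "disjnt (edges S) (edges T)" "inj_on (image f) (\<Union>(edges ` B))"
      using that B inj by (auto simp: pairwise_def)
    then show ?thesis
      using that by (subst disjnt_inj_on_iff[where \<A> = "edges ` B"]) auto
  qed
  then have "pairwise (\<lambda>S T. disjnt (edges S) (edges T)) (map_graph f ` B)"
    unfolding pairwise_image by (simp add: pairwise_def)
  moreover have "(\<Union>S\<in>map_graph f ` B. edges S) = image f ` E"
    using B by auto
  ultimately show ?thesis
    unfolding star_decomposition_def by blast
qed

lemma star_system_verts: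
  assumes "star_system e n V B" "S \<in> B"
  shows "verts S \<subseteq> V" "verts S \<noteq> {}"
proof -
  have "is_star e S" "subgraph S (complete_graph V)"
    using assms unfolding star_system_def by blast+
  then show "verts S \<subseteq> V" "verts S \<noteq> {}"
    unfolding is_star_iff subgraph_def by auto
qed

lemma star_system_map_graph:
  assumes "star_system e n V B" "inj_on f V" "e > 0"
  shows "star_system e n (f ` V) (map_graph f ` B)"
proof -
  note V = assms(1)[unfolded star_system_iff[OF assms(3)]]
  have "star_decomposition e (image f ` edges (complete_graph V)) (map_graph f ` B)"
  proof (rule star_decomposition_map_graph[OF _ assms(2)])
    show "edges (complete_graph V) \<subseteq> Pow V"
      by (auto simp: edges_complete_graph)
  qed (use V star_system_verts(1)[OF assms(1)] in auto)
  moreover have "image f ` edges (complete_graph V) = edges (complete_graph (f ` V))"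
    using edges_map_graph_complete_graph[OF assms(2)] by simp
  ultimately show ?thesis
    using V assms(2) unfolding star_system_iff[OF assms(3)] by (simp add: card_image)
qed

section \<open>Colourings of star systems\<close>

lemma colouring_iff:
  assumes "star_system e n V B"
  shows "colouring k V B c \<longleftrightarrow>
    c ` V \<subseteq> {..<k} \<and> (\<forall>S\<in>B. \<exists>x\<in>verts S. \<exists>y\<in>verts S. c x \<noteq> c y)"
proof -
  have "(\<exists>i<k. verts S \<subseteq> colour_class V c i) \<longleftrightarrow> (\<forall>x\<in>verts S. \<forall>y\<in>verts S. c x = c y)"
    if range: "c ` V \<subseteq> {..<k}" and "S \<in> B" for S
  proof
    assume const: "\<forall>x\<in>verts S. \<forall>y\<in>verts S. c x = c y"
    obtain x where x: "x \<in> verts S"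
      using star_system_verts(2)[OF assms \<open>S \<in> B\<close>] by blast
    then have "c x < k"
      using range star_system_verts(1)[OF assms \<open>S \<in> B\<close>] by auto
    moreover have "verts S \<subseteq> colour_class V c (c x)"
      using const x star_system_verts(1)[OF assms \<open>S \<in> B\<close>] unfolding colour_class_def by blast
    ultimately show "\<exists>i<k. verts S \<subseteq> colour_class V c i"
      by blast
  qed (unfold colour_class_def, blast)
  then show ?thesis
    unfolding colouring_def by metis
qed

lemma colouring_less: "colouring k V B c \<Longrightarrow> x \<in> V \<Longrightarrow> c x < k"
  unfolding colouring_def by auto

lemma colouring_mono:
  assumes "star_system e n V B" "colouring k V B c" "k \<le> l"
  shows "colouring l V B c"
  using assms(2,3) unfolding colouring_iff[OF assms(1)] by (auto dest: order_less_le_trans)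

lemma colouring_subsystem:
  assumes "star_system e n V B" "star_system e n' V' B'" "V \<subseteq> V'" "B \<subseteq> B'" "colouring k V' B' c"
  shows "colouring k V B c"
  using assms(3-5) unfolding colouring_iff[OF assms(1)] colouring_iff[OF assms(2)] by blast

lemma colouring_Un:
  assumes "star_system e n V B" "star_system e m W C" "star_system e l (V \<union> W) (B \<union> C \<union> X)"
    and "colouring k V B c" "colouring k W C c"
    and "\<And>S. S \<in> X \<Longrightarrow> \<exists>x\<in>verts S. \<exists>y\<in>verts S. c x \<noteq> c y"
  shows "colouring k (V \<union> W) (B \<union> C \<union> X) c"
  using assms(4-6)
  unfolding colouring_iff[OF assms(1)] colouring_iff[OF assms(2)] colouring_iff[OF assms(3)]
  by (simp add: image_Un ball_Un)

lemma colouring_cong: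
  assumes "\<And>x. x \<in> V \<Longrightarrow> c x = d x"
  shows "colouring k V B c \<longleftrightarrow> colouring k V B d"
proof -
  have "colour_class V c i = colour_class V d i" for i
    using assms unfolding colour_class_def by auto
  moreover have "c ` V = d ` V"
    using assms by (rule image_cong[OF refl])
  ultimately show ?thesis
    unfolding colouring_def by simp
qed

lemma colouring_map_graph:
  assumes "star_system e n V B"
  shows "colouring k (f ` V) (map_graph f ` B) c \<longleftrightarrow> colouring k V B (c \<circ> f)"
proof -
  have "f ` verts S \<subseteq> colour_class (f ` V) c i \<longleftrightarrow> verts S \<subseteq> colour_class V (c \<circ> f) i"
    if "S \<in> B" for S i
    using star_system_verts(1)[OF assms that] unfolding colour_class_def by auto
  then show ?thesis
    unfolding colouring_def by (auto simp: image_comp)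
qed

lemma colouring_star_centre_neq:
  assumes "star_system e n V B" "colouring k V B c" "star v L \<in> B" "\<And>x. x \<in> L \<Longrightarrow> c x = q"
  shows "c v \<noteq> q"
proof
  assume "c v = q"
  then have "\<forall>x\<in>verts (star v L). c x = q"
    using assms(4) by simp
  then show False
    using assms(2,3) unfolding colouring_iff[OF assms(1)] by metis
qed

lemma uniquely_colourableI:
  assumes "\<And>c. colouring k V B c \<Longrightarrow> \<exists>p. p permutes {..<k} \<and> (\<forall>x\<in>V. c x = p (r x))"
  shows "uniquely_colourable k V B"
  unfolding uniquely_colourable_def
proof (intro allI impI)
  fix c d assume "colouring k V B c" "colouring k V B d"
  then obtain p q where p: "p permutes {..<k}" "\<forall>x\<in>V. c x = p (r x)"
    and q: "q permutes {..<k}" "\<forall>x\<in>V. d x = q (r x)"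
    using assms by metis
  have "q \<circ> inv p permutes {..<k}"
    using permutes_compose[OF permutes_inv[OF p(1)] q(1)] .
  moreover have "\<forall>x\<in>V. d x = (q \<circ> inv p) (c x)"
    using p q(2) by (simp add: permutes_inverses(2))
  ultimately show "\<exists>p. p permutes {..<k} \<and> (\<forall>x\<in>V. d x = p (c x))" by blast
qed

lemma uniquely_colourable_imp_chromatic:
  assumes "star_system e n V B" "uniquely_colourable k V B"
    and "colouring k V B r" "r ` V = {..<k}" "k > 0"
  shows "chromatic k V B"
proof -
  have "\<not> colouring (k - 1) V B c" for c
  proof
    assume c: "colouring (k - 1) V B c"
    then have "colouring k V B c"
      using colouring_mono[OF assms(1)] by simp
    then obtain p where p: "p permutes {..<k}" "\<forall>x\<in>V. c x = p (r x)"
      using assms(2,3) unfolding uniquely_colourable_def by blast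
    then have "c ` V = p ` r ` V"
      unfolding image_image by (intro image_cong) auto
    then have "k - 1 \<in> c ` V"
      using permutes_image[OF p(1)] assms(4,5) by simp
    then show False
      using c unfolding colouring_def by auto
  qed
  then show ?thesis
    using assms(3) unfolding chromatic_def colourable_def by blast
qed

lemma strongly_equitable_uniquely_chromatic_map_graph:
  assumes "star_system e n V B" "inj_on f V" "strongly_equitable_uniquely_chromatic k V B"
  shows "strongly_equitable_uniquely_chromatic k (f ` V) (map_graph f ` B)"
proof -
  note colouring_image = colouring_map_graph[OF assms(1), of _ f]
  note system = assms(3)[unfolded strongly_equitable_uniquely_chromatic_def uniquely_colourable_def
      chromatic_def]
  have colouring_pullback:
    "colouring l V B c \<longleftrightarrow> colouring l (f ` V) (map_graph f ` B) (c \<circ> inv_into V f)" for l c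
    unfolding colouring_image using assms(2) by (intro colouring_cong) simp
  then have "colourable l (f ` V) (map_graph f ` B) \<longleftrightarrow> colourable l V B" for l
    unfolding colourable_def using colouring_image by blast
  then have "chromatic k (f ` V) (map_graph f ` B)"
    using system unfolding chromatic_def by blast
  moreover have "uniquely_colourable k (f ` V) (map_graph f ` B)"
    unfolding uniquely_colourable_def colouring_image using system by fastforce
  moreover obtain r where r: "colouring k V B r" "strongly_equitable k V r"
    using system by blast
  moreover have "strongly_equitable k (f ` V) (r \<circ> inv_into V f)"
  proof -
    have "colour_class (f ` V) (r \<circ> inv_into V f) i = f ` colour_class V r i" for i
      using assms(2) unfolding colour_class_def by auto
    moreover have "card (f ` colour_class V r i) = card (colour_class V r i)" for i
      using assms(2) by (intro card_image) (auto simp: colour_class_def inj_on_def)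
    ultimately have "card (colour_class (f ` V) (r \<circ> inv_into V f) i) = card (colour_class V r i)"
      for i by simp
    then show ?thesis
      using r(2) unfolding strongly_equitable_def by metis
  qed
  ultimately show ?thesis
    using colouring_pullback unfolding strongly_equitable_uniquely_chromatic_def by blast
qed

section \<open>Grid systems\<close>

abbreviation grid_colouring :: "nat \<Rightarrow> 'r set \<Rightarrow> ('r \<times> nat) graph set \<Rightarrow> ('r \<times> nat \<Rightarrow> nat) \<Rightarrow> bool" where
  "grid_colouring k A \<equiv> colouring k (A \<times> {..<k})"

definition grid_system :: "nat \<Rightarrow> nat \<Rightarrow> 'r set \<Rightarrow> ('r \<times> nat) graph set \<Rightarrow> bool" where
  "grid_system k e A B \<longleftrightarrow> finite A \<and> 2 * e dvd card A * k \<and>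
     star_system e (card A * k) (A \<times> {..<k}) B \<and> grid_colouring k A B snd"

lemma grid_systemD:
  assumes "grid_system k e A B"
  shows "finite A" "2 * e dvd card A * k" "e dvd card A * k"
    "star_system e (card A * k) (A \<times> {..<k}) B" "grid_colouring k A B snd"
  using assms unfolding grid_system_def by (auto dest: dvd_mult_right)

lemma grid_colouring_less: "grid_colouring k A B c \<Longrightarrow> a \<in> A \<Longrightarrow> i < k \<Longrightarrow> c (a, i) < k"
  by (simp add: colouring_less)

lemma grid_colouring_subsystem:
  assumes "grid_system k e A B" "grid_system k e A' D" "A \<subseteq> A'" "B \<subseteq> D" "grid_colouring k A' D c"
  shows "grid_colouring k A B c"
  using colouring_subsystem[OF assms(1,2)[THEN grid_systemD(4)] _ assms(4,5)] assms(3) by blast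

lemma grid_system_map_rows:
  assumes "grid_system k e A B" "inj_on f A" "e > 0"
  shows "grid_system k e (f ` A) (map_graph (map_prod f id) ` B)"
proof -
  let ?f = "map_prod f (id :: nat \<Rightarrow> nat)"
  note A = grid_systemD[OF assms(1)]
  have image: "?f ` (A \<times> {..<k}) = f ` A \<times> {..<k}"
    by (simp add: map_prod_surj_on)
  have "inj_on ?f (A \<times> {..<k})"
    using assms(2) by (simp add: map_prod_inj_on)
  then have "star_system e (card A * k) (f ` A \<times> {..<k}) (map_graph ?f ` B)"
    using star_system_map_graph[OF A(4) _ assms(3), of ?f] unfolding image by simp
  moreover have "snd \<circ> ?f = snd"
    by (simp add: fun_eq_iff)
  then have "grid_colouring k (f ` A) (map_graph ?f ` B) snd"
    using colouring_map_graph[OF A(4), of k ?f snd] A(5) unfolding image by simp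
  ultimately show ?thesis
    using A(1,2) assms(2) unfolding grid_system_def by (simp add: card_image)
qed

definition half_packing :: "nat \<Rightarrow> 'a set \<Rightarrow> 'a set set \<Rightarrow> bool" where
  "half_packing e R T \<longleftrightarrow> disjoint T \<and> (\<forall>H\<in>T. H \<subseteq> R \<and> card H = e) \<and> 2 * card (\<Union>T) \<le> card R"

lemma half_packing_empty [simp]: "half_packing e R {}"
  by (simp add: half_packing_def)

lemma half_packing_mono:
  assumes "half_packing e R T" "R \<subseteq> R'" "finite R'"
  shows "half_packing e R' T"
  using assms card_mono[OF assms(3,2)] unfolding half_packing_def by fastforce

lemma half_packing_singleton: "H \<subseteq> R \<Longrightarrow> card H = e \<Longrightarrow> 2 * e \<le> card R \<Longrightarrow> half_packing e R {H}"
  by (simp add: half_packing_def)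

lemma half_packing_labelled:
  assumes "finite I" "2 * (card I * N) \<le> card A"
    and G: "\<And>i. i \<in> I \<Longrightarrow> G i \<subseteq> A \<and> card (G i) = N \<and> (\<forall>a\<in>G i. g a = i)"
  shows "half_packing N A (G ` I)"
  unfolding half_packing_def
proof (intro conjI)
  show "disjoint (G ` I)"
  proof (rule disjointI)
    show "H \<inter> H' = {}" if "H \<in> G ` I" "H' \<in> G ` I" "H \<noteq> H'" for H H'
      using that G by (metis disjoint_iff imageE)
  qed
  show "\<forall>H\<in>G ` I. H \<subseteq> A \<and> card H = N"
    using G by blast
  have "card (\<Union>(G ` I)) \<le> (\<Sum>i\<in>I. card (G i))"
    using assms(1) by (rule card_UN_le)
  also have "\<dots> = card I * N"
    using G by simp
  finally show "2 * card (\<Union>(G ` I)) \<le> card A"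
    using assms(2) by linarith
qed

definition column_blocks :: "nat \<Rightarrow> nat \<Rightarrow> (nat \<Rightarrow> 'r set set) \<Rightarrow> ('r \<times> nat) set set" where
  "column_blocks k i T = {H \<times> {j} | H j. j < k \<and> j \<noteq> i \<and> H \<in> T j}"

lemma disjoint_column_blocks:
  assumes "\<And>j. j < k \<Longrightarrow> disjoint (T j)"
  shows "disjoint (column_blocks k i T)"
proof (rule disjointI)
  fix L L' assume "L \<in> column_blocks k i T" "L' \<in> column_blocks k i T" "L \<noteq> L'"
  then obtain H j H' j' where L: "j < k" "H \<in> T j" "L = H \<times> {j}" "H' \<in> T j'" "L' = H' \<times> {j'}"
    "j = j' \<longrightarrow> H \<noteq> H'"
    unfolding column_blocks_def by blast
  then show "L \<inter> L' = {}"
    using disjointD[OF assms[OF L(1)], of H H'] by auto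
qed

lemma card_Union_column_blocks:
  assumes "i < k" "\<And>j. j < k \<Longrightarrow> half_packing e R (T j)"
  shows "2 * card (\<Union>(column_blocks k i T)) \<le> card R * (k - 1)"
proof -
  let ?J = "{..<k} - {i}"
  have "\<Union>(column_blocks k i T) = (\<Union>j\<in>?J. \<Union>(T j) \<times> {j})"
    unfolding column_blocks_def by blast
  then have "card (\<Union>(column_blocks k i T)) \<le> (\<Sum>j\<in>?J. card (\<Union>(T j)))"
    using card_UN_le[of ?J "\<lambda>j. \<Union>(T j) \<times> {j}"] by (simp add: card_cartesian_product)
  then have "2 * card (\<Union>(column_blocks k i T)) \<le> (\<Sum>j\<in>?J. 2 * card (\<Union>(T j)))"
    by (simp add: sum_distrib_left[symmetric])
  also have "\<dots> \<le> (\<Sum>j\<in>?J. card R)"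
    using assms(2) unfolding half_packing_def by (intro sum_mono) auto
  also have "\<dots> = card R * (k - 1)"
    using assms(1) by (simp add: mult.commute)
  finally show ?thesis .
qed

lemma ex_leaf_partition:
  assumes "k \<ge> 3" "e \<ge> 2" "finite R" "e dvd card R * k" "i < k"
    and T: "\<And>j. j < k \<Longrightarrow> half_packing e R (T j)"
  shows "\<exists>Q. partition_on (R \<times> {..<k}) Q \<and> column_blocks k i T \<subseteq> Q \<and>
    (\<forall>L\<in>Q. card L = e \<and> \<not> L \<subseteq> UNIV \<times> {i})"
proof (rule ex_uniform_partition_extending)
  let ?F = "column_blocks k i T" and ?others = "R \<times> ({..<k} - {i})"
  have diff: "R \<times> {..<k} - UNIV \<times> {i} = ?others" and inter: "R \<times> {..<k} \<inter> UNIV \<times> {i} = R \<times> {i}"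
    using assms(5) by auto
  show "disjoint ?F"
    using T unfolding half_packing_def by (blast intro: disjoint_column_blocks)
  show blocks: "L \<subseteq> R \<times> {..<k} - UNIV \<times> {i} \<and> card L = e" if "L \<in> ?F" for L
    using that T unfolding column_blocks_def half_packing_def
    by (fastforce simp: card_cartesian_product)
  have "card R * 2 \<le> card R * (k - 1)"
    using assms(1) by (intro mult_le_mono) auto
  then have "card R \<le> card R * (k - 1) - card (\<Union>?F)"
    using card_Union_column_blocks[where T = T, OF assms(5) T] by linarith
  also have "\<dots> = card ?others - card (\<Union>?F)"
    using assms(5) by (simp add: card_cartesian_product)
  also have "\<dots> = card (?others - \<Union>?F)"
  proof (rule card_Diff_subset[symmetric])
    show "\<Union>?F \<subseteq> ?others"
      using blocks unfolding diff by blast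
    then show "finite (\<Union>?F)"
      by (rule finite_subset) (use assms(3) in simp)
  qed
  finally show "card (R \<times> {..<k} \<inter> UNIV \<times> {i}) \<le> card (R \<times> {..<k} - UNIV \<times> {i} - \<Union>?F)"
    unfolding diff inter by (simp add: card_cartesian_product)
qed (use assms in \<open>simp_all add: card_cartesian_product\<close>)

definition row_sees :: "nat \<Rightarrow> ('r \<times> nat) graph set \<Rightarrow> 'r \<Rightarrow> nat \<Rightarrow> 'r set \<Rightarrow> bool" where
  "row_sees k D a j H \<longleftrightarrow> (\<forall>i<k. i \<noteq> j \<longrightarrow> star (a, i) (H \<times> {j}) \<in> D)"

lemma row_sees_colour_neq:
  assumes "grid_system k e A D" "grid_colouring k A D c" "row_sees k D a j H"
    and "\<And>h. h \<in> H \<Longrightarrow> c (h, j) = q" "i < k" "i \<noteq> j"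
  shows "c (a, i) \<noteq> q"
proof (rule colouring_star_centre_neq[OF grid_systemD(4)[OF assms(1)] assms(2)])
  show "star (a, i) (H \<times> {j}) \<in> D"
    using assms(3,5,6) unfolding row_sees_def by blast
qed (use assms(4) in auto)

lemma grid_system_join_partitions:
  assumes A: "grid_system k e A B" and A': "grid_system k e A' B'" and disj: "A \<inter> A' = {}"
    and "e > 0"
    and R_A: "\<And>a. a \<in> A \<Longrightarrow> R a \<subseteq> A'" and R_A': "\<And>a. a \<in> A' \<Longrightarrow> R a \<subseteq> A"
    and orient: "\<And>a a'. a \<in> A \<Longrightarrow> a' \<in> A' \<Longrightarrow> a' \<in> R a \<longleftrightarrow> a \<notin> R a'"
    and part: "\<And>v. v \<in> (A \<union> A') \<times> {..<k} \<Longrightarrow> partition_on (R (fst v) \<times> {..<k}) (P v)"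
    and leaves: "\<And>v L. v \<in> (A \<union> A') \<times> {..<k} \<Longrightarrow> L \<in> P v \<Longrightarrow> card L = e \<and> \<not> L \<subseteq> UNIV \<times> {snd v}"
  shows "grid_system k e (A \<union> A') (B \<union> B' \<union> {star v L | v L. v \<in> (A \<union> A') \<times> {..<k} \<and> L \<in> P v})"
    (is "grid_system k e _ (B \<union> B' \<union> ?X)")
proof -
  note grid_A = grid_systemD[OF A] and grid_A' = grid_systemD[OF A']
  have V: "(A \<union> A') \<times> {..<k} = A \<times> {..<k} \<union> A' \<times> {..<k}"
    by auto
  have card: "card (A \<union> A') * k = card A * k + card A' * k"
    using grid_A(1) grid_A'(1) disj by (simp add: card_Un_disjoint algebra_simps)
  have sys: "star_system e (card (A \<union> A') * k) (A \<times> {..<k} \<union> A' \<times> {..<k}) (B \<union> B' \<union> ?X)"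
    unfolding card V
  proof (rule star_system_join[OF grid_A(4) grid_A'(4), where Out = "\<lambda>v. R (fst v) \<times> {..<k}"])
    show "R (fst v) \<times> {..<k} \<subseteq> A' \<times> {..<k}" if "v \<in> A \<times> {..<k}" for v
      using that R_A[of "fst v"] by auto
    show "R (fst v) \<times> {..<k} \<subseteq> A \<times> {..<k}" if "v \<in> A' \<times> {..<k}" for v
      using that R_A'[of "fst v"] by auto
    show "w \<in> R (fst v) \<times> {..<k} \<longleftrightarrow> v \<notin> R (fst w) \<times> {..<k}"
      if "v \<in> A \<times> {..<k}" "w \<in> A' \<times> {..<k}" for v w
      using that orient[of "fst v" "fst w"] by auto
  qed (use disj part leaves \<open>e > 0\<close> V in auto)
  have "colouring k (A \<times> {..<k} \<union> A' \<times> {..<k}) (B \<union> B' \<union> ?X) snd"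
  proof (rule colouring_Un[OF grid_A(4) grid_A'(4) sys grid_A(5) grid_A'(5)])
    fix S assume "S \<in> ?X"
    then obtain v L where S: "v \<in> (A \<union> A') \<times> {..<k}" "L \<in> P v" "S = star v L"
      by blast
    then have "\<not> L \<subseteq> UNIV \<times> {snd v}"
      using leaves by blast
    then show "\<exists>x\<in>verts S. \<exists>y\<in>verts S. snd x \<noteq> snd y"
      using S(3) by fastforce
  qed
  then show ?thesis
    using sys grid_A(1,2) grid_A'(1,2) unfolding grid_system_def V card by simp
qed

lemma grid_system_join:
  assumes "k \<ge> 3" "e \<ge> 2"
    and A: "grid_system k e A B" and A': "grid_system k e A' B'" and disj: "A \<inter> A' = {}"
    and R_A: "\<And>a. a \<in> A \<Longrightarrow> R a \<subseteq> A'" and R_A': "\<And>a. a \<in> A' \<Longrightarrow> R a \<subseteq> A"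
    and orient: "\<And>a a'. a \<in> A \<Longrightarrow> a' \<in> A' \<Longrightarrow> a' \<in> R a \<longleftrightarrow> a \<notin> R a'"
    and dvd: "\<And>a. a \<in> A \<union> A' \<Longrightarrow> e dvd card (R a) * k"
    and T: "\<And>a j. a \<in> A \<union> A' \<Longrightarrow> j < k \<Longrightarrow> half_packing e (R a) (T a j)"
  shows "\<exists>D. grid_system k e (A \<union> A') D \<and> B \<subseteq> D \<and> B' \<subseteq> D \<and>
    (\<forall>a\<in>A \<union> A'. \<forall>j<k. \<forall>H\<in>T a j. row_sees k D a j H)"
proof -
  let ?V = "(A \<union> A') \<times> {..<k}"
  have "finite (R a)" if "a \<in> A \<union> A'" for a
    using that R_A R_A' grid_systemD(1)[OF A] grid_systemD(1)[OF A'] by (meson UnE finite_subset)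
  then have "\<exists>Q. partition_on (R (fst v) \<times> {..<k}) Q \<and> column_blocks k (snd v) (T (fst v)) \<subseteq> Q \<and>
      (\<forall>L\<in>Q. card L = e \<and> \<not> L \<subseteq> UNIV \<times> {snd v})" if "v \<in> ?V" for v
    using that dvd T by (intro ex_leaf_partition[OF assms(1,2)]) auto
  then obtain P where P: "\<And>v. v \<in> ?V \<Longrightarrow> partition_on (R (fst v) \<times> {..<k}) (P v) \<and>
      column_blocks k (snd v) (T (fst v)) \<subseteq> P v \<and> (\<forall>L\<in>P v. card L = e \<and> \<not> L \<subseteq> UNIV \<times> {snd v})"
    by metis
  let ?D = "B \<union> B' \<union> {star v L | v L. v \<in> ?V \<and> L \<in> P v}"
  have "grid_system k e (A \<union> A') ?D"
    using P assms(2) by (intro grid_system_join_partitions[OF A A' disj _ R_A R_A' orient]) auto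
  moreover have "row_sees k ?D a j H" if "a \<in> A \<union> A'" "j < k" "H \<in> T a j" for a j H
    unfolding row_sees_def
  proof (intro allI impI)
    fix i assume i: "i < k" "i \<noteq> j"
    have v: "(a, i) \<in> ?V"
      using that(1) i(1) by blast
    have "H \<times> {j} \<in> column_blocks k i (T a)"
      using that(2,3) i(2) unfolding column_blocks_def by blast
    then have "H \<times> {j} \<in> P (a, i)"
      using P[OF v] by auto
    then show "star (a, i) (H \<times> {j}) \<in> ?D"
      using v by blast
  qed
  ultimately show ?thesis
    by blast
qed

lemma grid_system_attach:
  assumes "k \<ge> 3" "e \<ge> 2"
    and A: "grid_system k e A B" and U: "grid_system k e U C" and disj: "A \<inter> U = {}"
    and T: "\<And>a j. a \<in> U \<Longrightarrow> j < k \<Longrightarrow> half_packing e A (T a j)"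
  shows "\<exists>D. grid_system k e (A \<union> U) D \<and> B \<subseteq> D \<and> (\<forall>a\<in>U. \<forall>j<k. \<forall>H\<in>T a j. row_sees k D a j H)"
proof -
  let ?R = "\<lambda>a. if a \<in> U then A else {}" and ?T = "\<lambda>a j. if a \<in> U then T a j else {}"
  have "\<exists>D. grid_system k e (A \<union> U) D \<and> B \<subseteq> D \<and> C \<subseteq> D \<and>
      (\<forall>a\<in>A \<union> U. \<forall>j<k. \<forall>H\<in>?T a j. row_sees k D a j H)"
    by (rule grid_system_join[OF assms(1,2) A U disj, where R = ?R])
      (use disj T grid_systemD(3)[OF A] in auto)
  then show ?thesis by fastforce
qed

section \<open>Rigid rows\<close>

lemma permutes_eqI_avoiding:
  assumes "p permutes S" "x \<in> S" "x \<notin> p ` (S - {i})"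
  shows "x = p i"
  using assms permutes_image[OF assms(1)] by blast

definition rows_coloured_by :: "nat \<Rightarrow> 'r set \<Rightarrow> ('r \<times> nat \<Rightarrow> nat) \<Rightarrow> (nat \<Rightarrow> nat) \<Rightarrow> bool" where
  "rows_coloured_by k U c p \<longleftrightarrow> p permutes {..<k} \<and> (\<forall>a\<in>U. \<forall>i<k. c (a, i) = p i)"

definition rigid_rows :: "nat \<Rightarrow> 'r set \<Rightarrow> ('r \<times> nat) graph set \<Rightarrow> 'r set \<Rightarrow> bool" where
  "rigid_rows k A B U \<longleftrightarrow> (\<forall>c. grid_colouring k A B c \<longrightarrow> (\<exists>p. rows_coloured_by k U c p))"

lemma rows_coloured_by_Un:
  "rows_coloured_by k U c p \<Longrightarrow> rows_coloured_by k W c p \<Longrightarrow> rows_coloured_by k (U \<union> W) c p"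
  unfolding rows_coloured_by_def by blast

lemma rows_coloured_by_subset: "rows_coloured_by k U c p \<Longrightarrow> W \<subseteq> U \<Longrightarrow> rows_coloured_by k W c p"
  unfolding rows_coloured_by_def by blast

lemma rows_coloured_by_if_avoiding:
  assumes "grid_colouring k A D c" "U \<subseteq> A" "p permutes {..<k}"
    and "\<And>a i j. a \<in> U \<Longrightarrow> i < k \<Longrightarrow> j < k \<Longrightarrow> j \<noteq> i \<Longrightarrow> c (a, i) \<noteq> p j"
  shows "rows_coloured_by k U c p"
  unfolding rows_coloured_by_def
proof (intro conjI ballI allI impI)
  fix a i assume "a \<in> U" "i < k"
  then have "c (a, i) \<in> {..<k}"
    using grid_colouring_less[OF assms(1)] assms(2) by auto
  moreover have "c (a, i) \<notin> p ` ({..<k} - {i})"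
    using assms(4)[OF \<open>a \<in> U\<close> \<open>i < k\<close>] by blast
  ultimately show "c (a, i) = p i"
    by (rule permutes_eqI_avoiding[OF assms(3)])
qed fact

lemma rows_coloured_by_if_sees:
  assumes "grid_system k e A D" "grid_colouring k A D c" "rows_coloured_by k H c p" "U \<subseteq> A"
    and "\<And>a j. a \<in> U \<Longrightarrow> j < k \<Longrightarrow> row_sees k D a j H"
  shows "rows_coloured_by k U c p"
proof (rule rows_coloured_by_if_avoiding[OF assms(2,4)])
  show "c (a, i) \<noteq> p j" if "a \<in> U" "i < k" "j < k" "j \<noteq> i" for a i j
    using row_sees_colour_neq[OF assms(1,2) assms(5)[OF that(1,3)] _ that(2)] assms(3) that(3,4)
    unfolding rows_coloured_by_def by auto
qed (use assms(3) in \<open>simp add: rows_coloured_by_def\<close>)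

lemma rigid_rows_Un_if_sees:
  assumes A: "grid_system k e A B" "U \<subseteq> A" "rigid_rows k A B U"
    and D: "grid_system k e (A \<union> W) D" "B \<subseteq> D" and "H \<subseteq> U" "I \<subseteq> W"
    and sees_H: "\<And>a j. a \<in> W \<Longrightarrow> j < k \<Longrightarrow> row_sees k D a j H"
    and sees_I: "\<And>a j. a \<in> A - U \<Longrightarrow> j < k \<Longrightarrow> row_sees k D a j I"
  shows "rigid_rows k (A \<union> W) D (A \<union> W)"
  unfolding rigid_rows_def
proof (intro allI impI)
  fix c assume c: "grid_colouring k (A \<union> W) D c"
  have "grid_colouring k A B c"
    using grid_colouring_subsystem[OF A(1) D(1) _ D(2) c] by simp
  then obtain p where U: "rows_coloured_by k U c p"
    using A(3) unfolding rigid_rows_def by blast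
  have W: "rows_coloured_by k W c p"
    by (rule rows_coloured_by_if_sees[OF D(1) c rows_coloured_by_subset[OF U \<open>H \<subseteq> U\<close>]])
      (use sees_H in auto)
  have "rows_coloured_by k (A - U) c p"
    by (rule rows_coloured_by_if_sees[OF D(1) c rows_coloured_by_subset[OF W \<open>I \<subseteq> W\<close>]])
      (use sees_I in auto)
  then have "rows_coloured_by k (A - U \<union> U \<union> W) c p"
    using U W by (intro rows_coloured_by_Un)
  moreover have "A - U \<union> U \<union> W = A \<union> W"
    using A(2) by blast
  ultimately show "\<exists>p. rows_coloured_by k (A \<union> W) c p"
    by auto
qed

lemma ex_rigid_join:
  assumes "k \<ge> 3" "e \<ge> 2"
    and A: "grid_system k e A B" "U \<subseteq> A" "2 * e \<le> card U" "e dvd card U * k" "rigid_rows k A B U"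
    and W: "grid_system k e W C" "2 * e \<le> card W" and disj: "A \<inter> W = {}"
  shows "\<exists>D. grid_system k e (A \<union> W) D \<and> rigid_rows k (A \<union> W) D (A \<union> W)"
proof -
  have "e \<le> card U" "e \<le> card W"
    using A(3) W(2) by simp_all
  then obtain H I where H: "H \<subseteq> U" "card H = e" and I: "I \<subseteq> W" "card I = e"
    by (metis obtain_subset_with_card_n)
  define R where "R a = (if a \<in> W then U else if a \<in> U then {} else W)" for a
  define T where "T a = (if a \<in> W then {H} else if a \<in> U then {} else {I})" for a
  have "\<exists>D. grid_system k e (A \<union> W) D \<and> B \<subseteq> D \<and> C \<subseteq> D \<and>
      (\<forall>a\<in>A \<union> W. \<forall>j<k. \<forall>H\<in>T a. row_sees k D a j H)"
  proof (rule grid_system_join[OF assms(1,2) A(1) W(1) disj, where R = R and T = "\<lambda>a _. T a"])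
    show "e dvd card (R a) * k" for a
      using A(4) grid_systemD(3)[OF W(1)] by (simp add: R_def)
    show "half_packing e (R a) (T a)" for a
      using H I A(3) W(2) by (simp add: R_def T_def half_packing_singleton)
  qed (use A(2) disj in \<open>auto simp: R_def split: if_splits\<close>)
  then obtain D where D: "grid_system k e (A \<union> W) D" "B \<subseteq> D"
    and sees: "\<And>a j J. a \<in> A \<union> W \<Longrightarrow> j < k \<Longrightarrow> J \<in> T a \<Longrightarrow> row_sees k D a j J"
    by blast
  have "rigid_rows k (A \<union> W) D (A \<union> W)"
    by (rule rigid_rows_Un_if_sees[OF A(1,2,5) D H(1) I(1)])
      (use disj in \<open>auto intro!: sees simp: T_def\<close>)
  then show ?thesis
    using D(1) by blast
qed

section \<open>Construction of a rigid grid\<close>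

lemma ex_inj_range_disjoint:
  assumes "finite (X :: nat set)"
  shows "\<exists>f :: nat \<Rightarrow> nat. inj f \<and> range f \<inter> X = {}"
proof -
  obtain s where "\<And>x. x \<in> X \<Longrightarrow> x < s"
    using assms finite_nat_set_iff_bounded by auto
  then have "range (\<lambda>a. a + s) \<inter> X = {}"
    by fastforce
  then show ?thesis
    by (intro exI[of _ "\<lambda>a. a + s"]) (simp add: inj_def)
qed

lemma ex_labelled_subsets:
  assumes "finite I" "finite A" "card I * N \<le> card A"
  shows "\<exists>G g. \<forall>i\<in>I. G i \<subseteq> A \<and> card (G i) = N \<and> (\<forall>a\<in>G i. g a = i)"
proof -
  obtain h where h: "h ` (I \<times> {..<N}) \<subseteq> A" "inj_on h (I \<times> {..<N})"
    using card_le_inj[of "I \<times> {..<N}" A] assms by (auto simp: card_cartesian_product)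
  show ?thesis
  proof (intro exI ballI conjI)
    fix i assume i: "i \<in> I"
    show "h ` ({i} \<times> {..<N}) \<subseteq> A"
      using h(1) i by auto
    have "inj_on h ({i} \<times> {..<N})"
      using h(2) i by (auto intro: inj_on_subset)
    then show "card (h ` ({i} \<times> {..<N})) = N"
      by (simp add: card_image card_cartesian_product)
    show "fst (inv_into (I \<times> {..<N}) h a) = i" if "a \<in> h ` ({i} \<times> {..<N})" for a
      using that i h(2) by auto
  qed
qed

lemma ex_permutes_update:
  assumes "p permutes S" "t \<in> S" "q \<in> S" "t \<notin> I" "q \<notin> p ` I"
  shows "\<exists>p'. p' permutes S \<and> p' t = q \<and> (\<forall>i\<in>I. p' i = p i)"
proof (intro exI conjI ballI)
  have "p t \<in> S"
    using assms(1,2) by (simp add: permutes_in_image)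
  then show "transpose (p t) q \<circ> p permutes S"
    using assms(1,3) by (intro permutes_compose permutes_swap_id)
  show "(transpose (p t) q \<circ> p) i = p i" if "i \<in> I" for i
  proof -
    have "p i \<noteq> p t" "p i \<noteq> q"
      using that assms permutes_inj[OF assms(1)] by (auto simp: inj_eq)
    then show ?thesis
      by simp
  qed
qed simp

lemma ex_popular_colour:
  assumes "grid_colouring k A B c" "finite A" "H \<subseteq> A" "card H = k * e" "i < k"
  shows "\<exists>q<k. e \<le> card {a \<in> H. c (a, i) = q}"
proof -
  have "(\<lambda>a. c (a, i)) \<in> H \<rightarrow> {..<k}"
    using grid_colouring_less[OF assms(1)] assms(3,5) by blast
  moreover have "finite H"
    using assms(2,3) by (rule finite_subset[rotated])
  moreover have "{..<k} \<noteq> {}"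
    using assms(5) by blast
  ultimately obtain q where "q < k" "card H \<le> card ((\<lambda>a. c (a, i)) -` {q} \<inter> H) * k"
    using pigeonhole_card[of "\<lambda>a. c (a, i)" H "{..<k}"] by auto
  moreover have "(\<lambda>a. c (a, i)) -` {q} \<inter> H = {a \<in> H. c (a, i) = q}"
    by auto
  ultimately show ?thesis
    using assms(4,5) by (auto simp: mult.commute)
qed

locale grid_base =
  fixes k e :: nat and A\<^sub>0 B\<^sub>0
  assumes k: "k \<ge> 3" and e: "e \<ge> 2" and base: "grid_system k e (A\<^sub>0 :: nat set) B\<^sub>0" "A\<^sub>0 \<noteq> {}"
begin

lemma ex_disjoint_grid_system:
  assumes "finite (X :: nat set)"
  shows "\<exists>A B. grid_system k e A B \<and> A \<inter> X = {} \<and> A \<noteq> {}"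
proof -
  obtain f :: "nat \<Rightarrow> nat" where f: "inj f" "range f \<inter> X = {}"
    using ex_inj_range_disjoint[OF assms] by blast
  have "grid_system k e (f ` A\<^sub>0) (map_graph (map_prod f id) ` B\<^sub>0)"
    using grid_system_map_rows[OF base(1) inj_on_subset[OF f(1) subset_UNIV]] e by simp
  then show ?thesis
    using f(2) base(2) by blast
qed

lemma ex_large_disjoint_grid_system:
  assumes "finite (X :: nat set)"
  shows "\<exists>A B. grid_system k e A B \<and> A \<inter> X = {} \<and> N \<le> card A"
proof (induction N)
  case 0
  then show ?case
    using ex_disjoint_grid_system[OF assms] by blast
next
  case (Suc N)
  then obtain A B where A: "grid_system k e A B" "A \<inter> X = {}" "N \<le> card A"
    by blast
  note finA = grid_systemD(1)[OF A(1)]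
  obtain U C where U: "grid_system k e U C" "U \<inter> (X \<union> A) = {}" "U \<noteq> {}"
    using ex_disjoint_grid_system[of "X \<union> A"] assms finA by blast
  note finU = grid_systemD(1)[OF U(1)]
  have AU: "A \<inter> U = {}"
    using U(2) by blast
  obtain D where "grid_system k e (A \<union> U) D"
    using grid_system_attach[OF k e A(1) U(1) AU, of "\<lambda>_ _. {}"] by auto
  moreover have "Suc N \<le> card (A \<union> U)"
  proof -
    have "card U > 0"
      using U(3) finU by (simp add: card_gt_0_iff)
    then show ?thesis
      using A(3) AU finA finU by (simp add: card_Un_disjoint)
  qed
  ultimately show ?case
    using A(2) U(2) by blast
qed

text \<open>Every colouring \<open>f\<close> of the old grid gets \<open>N\<close> new rows seeing the blocks \<open>T f\<close>. Whatever
  colouring \<open>c\<close> the new grid receives, the rows for its restriction to the old grid are among them.\<close>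

lemma ex_indexed_rows:
  assumes A: "grid_system k e (A :: nat set) B"
    and T: "\<And>c j. grid_colouring k A B c \<Longrightarrow> j < k \<Longrightarrow> half_packing e A (T c j)"
  shows "\<exists>A' D \<F>. grid_system k e A' D \<and> A \<subseteq> A' \<and> B \<subseteq> D \<and> half_packing N A' \<F> \<and>
    (\<forall>c. grid_colouring k A' D c \<longrightarrow>
      (\<exists>H\<in>\<F>. \<forall>a\<in>H. \<forall>j<k. \<forall>J\<in>T (restrict c (A \<times> {..<k})) j. row_sees k D a j J))"
proof -
  define \<Phi> where "\<Phi> = {c \<in> A \<times> {..<k} \<rightarrow>\<^sub>E {..<k}. grid_colouring k A B c}"
  note finA = grid_systemD(1)[OF A]
  have "finite \<Phi>"
    unfolding \<Phi>_def using finA finite_PiE[of "A \<times> {..<k}" "\<lambda>_. {..<k}"] by simp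
  obtain U C where U: "grid_system k e U C" "U \<inter> A = {}" "2 * (card \<Phi> * N) \<le> card U"
    using ex_large_disjoint_grid_system[OF finA] by blast
  note finU = grid_systemD(1)[OF U(1)]
  obtain G g where G: "\<And>f. f \<in> \<Phi> \<Longrightarrow> G f \<subseteq> U \<and> card (G f) = N \<and> (\<forall>a\<in>G f. g a = f)"
    using ex_labelled_subsets[OF \<open>finite \<Phi>\<close> finU, of N] U(3) by fastforce
  have "half_packing e A (if g a \<in> \<Phi> then T (g a) j else {})" if "j < k" for a j
    using T that by (simp add: \<Phi>_def)
  then obtain D where D: "grid_system k e (A \<union> U) D" "B \<subseteq> D"
    and sees: "\<And>a j H. a \<in> U \<Longrightarrow> g a \<in> \<Phi> \<Longrightarrow> j < k \<Longrightarrow> H \<in> T (g a) j \<Longrightarrow> row_sees k D a j H"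
    using grid_system_attach[OF k e A U(1), of "\<lambda>a j. if g a \<in> \<Phi> then T (g a) j else {}"] U(2)
    by (auto simp: Int_commute)
  have "half_packing N (A \<union> U) (G ` \<Phi>)"
    using half_packing_mono[OF half_packing_labelled[OF \<open>finite \<Phi>\<close> U(3) G]] finA finU by simp
  moreover have "\<exists>H\<in>G ` \<Phi>. \<forall>a\<in>H. \<forall>j<k. \<forall>J\<in>T (restrict c (A \<times> {..<k})) j. row_sees k D a j J"
    if "grid_colouring k (A \<union> U) D c" for c
  proof -
    let ?f = "restrict c (A \<times> {..<k})"
    have c: "grid_colouring k A B c"
      using grid_colouring_subsystem[OF A D(1) _ D(2) that] by simp
    then have "grid_colouring k A B ?f"
      using colouring_cong[of "A \<times> {..<k}" ?f c] by simp
    moreover have "?f \<in> A \<times> {..<k} \<rightarrow>\<^sub>E {..<k}"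
      using grid_colouring_less[OF c] by auto
    ultimately have f: "?f \<in> \<Phi>"
      unfolding \<Phi>_def by simp
    then have "row_sees k D a j J" if "a \<in> G ?f" "j < k" "J \<in> T ?f j" for a j J
      using sees[of a j J] G that by auto
    then show ?thesis
      using f by blast
  qed
  ultimately show ?thesis
    using D by blast
qed

definition anchored :: "nat set \<Rightarrow> nat \<Rightarrow> (nat \<times> nat \<Rightarrow> nat) \<Rightarrow> (nat \<Rightarrow> nat) \<Rightarrow> bool" where
  "anchored A t c p \<longleftrightarrow> p permutes {..<k} \<and> (\<forall>i<t. e \<le> card {a \<in> A. c (a, i) = p i})"

lemma anchored_mono:
  assumes "anchored A t c p" "A \<subseteq> A'" "finite A'"
  shows "anchored A' t c p"
proof -
  have "card {a \<in> A. c (a, i) = p i} \<le> card {a \<in> A'. c (a, i) = p i}" for i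
    using assms(2,3) by (intro card_mono) auto
  then show ?thesis
    using assms(1) unfolding anchored_def by (meson order_trans)
qed

lemma anchored_restrict:
  assumes "t \<le> k"
  shows "anchored A t (restrict c (A \<times> {..<k})) p \<longleftrightarrow> anchored A t c p"
proof -
  have "{a \<in> A. restrict c (A \<times> {..<k}) (a, i) = p i} = {a \<in> A. c (a, i) = p i}" if "i < t" for i
    using that assms by auto
  then show ?thesis
    unfolding anchored_def by simp
qed

lemma ex_avoiding_rows:
  assumes A: "grid_system k e (A :: nat set) B" "2 * e \<le> card A" and "t \<le> k"
    and anchored: "\<And>c. grid_colouring k A B c \<Longrightarrow> \<exists>p. anchored A t c p"
  shows "\<exists>A' D \<F>. grid_system k e A' D \<and> A \<subseteq> A' \<and> half_packing N A' \<F> \<and>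
    (\<forall>c. grid_colouring k A' D c \<longrightarrow>
      (\<exists>p. anchored A t c p \<and> (\<exists>H\<in>\<F>. \<forall>a\<in>H. \<forall>i<k. c (a, i) \<notin> p ` ({..<t} - {i}))))"
proof -
  obtain p where p: "\<And>c. grid_colouring k A B c \<Longrightarrow> anchored A t c (p c)"
    using anchored by metis
  then have "\<exists>G. G \<subseteq> {a \<in> A. c (a, i) = p c i} \<and> card G = e"
    if "grid_colouring k A B c" "i < t" for c i
    using that unfolding anchored_def by (meson obtain_subset_with_card_n)
  then obtain G where G: "\<And>c i. grid_colouring k A B c \<Longrightarrow> i < t \<Longrightarrow>
      G c i \<subseteq> {a \<in> A. c (a, i) = p c i} \<and> card (G c i) = e"
    by metis
  define T where "T c j = (if j < t then {G c j} else {})" for c j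
  have "half_packing e A (T c j)" if "grid_colouring k A B c" for c j
    using G[OF that, of j] A(2) by (auto simp: T_def intro!: half_packing_singleton)
  then obtain A' D \<F> where D: "grid_system k e A' D" "A \<subseteq> A'" "B \<subseteq> D" "half_packing N A' \<F>"
    and sees: "\<And>c. grid_colouring k A' D c \<Longrightarrow>
      \<exists>H\<in>\<F>. \<forall>a\<in>H. \<forall>j<k. \<forall>J\<in>T (restrict c (A \<times> {..<k})) j. row_sees k D a j J"
    using ex_indexed_rows[OF A(1), of T N] by blast
  have "\<exists>p. anchored A t c p \<and> (\<exists>H\<in>\<F>. \<forall>a\<in>H. \<forall>i<k. c (a, i) \<notin> p ` ({..<t} - {i}))"
    if c: "grid_colouring k A' D c" for c
  proof -
    let ?f = "restrict c (A \<times> {..<k})"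
    have "grid_colouring k A B c"
      using grid_colouring_subsystem[OF A(1) D(1-3) c] .
    then have f: "grid_colouring k A B ?f"
      using colouring_cong[of "A \<times> {..<k}" ?f c] by simp
    have "anchored A t c (p ?f)"
      using p[OF f] anchored_restrict[OF \<open>t \<le> k\<close>] by blast
    moreover obtain H where H: "H \<in> \<F>" "\<And>a j. a \<in> H \<Longrightarrow> j < t \<Longrightarrow> row_sees k D a j (G ?f j)"
      using sees[OF c] \<open>t \<le> k\<close> by (auto simp: T_def)
    have "c (a, i) \<noteq> p ?f j" if "a \<in> H" "i < k" "j < t" "j \<noteq> i" for a i j
    proof (rule row_sees_colour_neq[OF D(1) c H(2)[OF that(1,3)] _ that(2)])
      show "c (h, j) = p ?f j" if "h \<in> G ?f j" for h
        using that G[OF f \<open>j < t\<close>] \<open>j < t\<close> \<open>t \<le> k\<close> by auto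
    qed (use that in simp)
    then have "\<forall>a\<in>H. \<forall>i<k. c (a, i) \<notin> p ?f ` ({..<t} - {i})"
      by auto
    ultimately show ?thesis
      using H(1) by blast
  qed
  then show ?thesis
    using D by blast
qed

lemma ex_anchored_Suc:
  assumes c: "grid_colouring k A' D c" and A': "finite A'" "A \<subseteq> A'" and p: "anchored A t c p"
    and H: "H \<subseteq> A'" "card H = k * e" and "t < k" and new: "\<And>a. a \<in> H \<Longrightarrow> c (a, t) \<notin> p ` {..<t}"
  shows "\<exists>p'. anchored A' (Suc t) c p'"
proof -
  obtain q where q: "q < k" "e \<le> card {a \<in> H. c (a, t) = q}"
    using ex_popular_colour[OF c A'(1) H \<open>t < k\<close>] by blast
  then have "{a \<in> H. c (a, t) = q} \<noteq> {}"
    using e by (metis card.empty not_numeral_le_zero order_trans)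
  then have "q \<notin> p ` {..<t}"
    using new by blast
  then obtain p' where p': "p' permutes {..<k}" "p' t = q" "\<And>i. i < t \<Longrightarrow> p' i = p i"
    using ex_permutes_update[of p "{..<k}" t q "{..<t}"] p q(1) \<open>t < k\<close>
    unfolding anchored_def by auto
  have "card {a \<in> H. c (a, t) = q} \<le> card {a \<in> A'. c (a, t) = q}"
    using A'(1) H(1) by (intro card_mono) auto
  then have "anchored A' (Suc t) c p'"
    using p' q(2) anchored_mono[OF p A'(2,1)] unfolding anchored_def by (auto simp: less_Suc_eq)
  then show ?thesis
    by blast
qed

lemma ex_anchored_grid_system:
  assumes "t \<le> k"
  shows "\<exists>(A :: nat set) B. grid_system k e A B \<and> 2 * e \<le> card A \<and>
    (\<forall>c. grid_colouring k A B c \<longrightarrow> (\<exists>p. anchored A t c p))"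
  using assms
proof (induction t)
  case 0
  obtain A :: "nat set" and B where "grid_system k e A B" "2 * e \<le> card A"
    using ex_large_disjoint_grid_system[of "{}"] by blast
  moreover have "anchored A 0 c id" for c
    by (simp add: anchored_def)
  ultimately show ?case
    by blast
next
  case (Suc t)
  then obtain A B where A: "grid_system k e A B" "2 * e \<le> card A"
    "\<And>c. grid_colouring k A B c \<Longrightarrow> \<exists>p. anchored A t c p"
    by auto
  have "t < k"
    using Suc.prems by simp
  obtain A' D \<F> where D: "grid_system k e A' D" "A \<subseteq> A'" "half_packing (k * e) A' \<F>"
    and avoiding: "\<And>c. grid_colouring k A' D c \<Longrightarrow> \<exists>p. anchored A t c p \<and>
      (\<exists>H\<in>\<F>. \<forall>a\<in>H. \<forall>i<k. c (a, i) \<notin> p ` ({..<t} - {i}))"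
    using ex_avoiding_rows[OF A(1,2) less_imp_le[OF \<open>t < k\<close>] A(3), of "k * e"] by auto
  note finA' = grid_systemD(1)[OF D(1)]
  have "\<exists>p. anchored A' (Suc t) c p" if c: "grid_colouring k A' D c" for c
  proof -
    obtain p H where p: "anchored A t c p" and H: "H \<in> \<F>"
      and new: "\<And>a. a \<in> H \<Longrightarrow> c (a, t) \<notin> p ` {..<t}"
      using avoiding[OF c] \<open>t < k\<close> by fastforce
    have "H \<subseteq> A'" "card H = k * e"
      using D(3) H unfolding half_packing_def by auto
    then show ?thesis
      using ex_anchored_Suc[OF c finA' D(2) p _ _ \<open>t < k\<close> new] by blast
  qed
  moreover have "2 * e \<le> card A'"
    using A(2) D(2) finA' by (meson card_mono order_trans)
  ultimately show ?case
    using D(1) by blast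
qed

lemma ex_grid_system_with_rigid_block:
  "\<exists>(A :: nat set) B \<F>. grid_system k e A B \<and> half_packing e A \<F> \<and>
    (\<forall>c. grid_colouring k A B c \<longrightarrow> (\<exists>H\<in>\<F>. \<exists>p. rows_coloured_by k H c p))"
proof -
  obtain A\<^sub>1 B\<^sub>1 where A\<^sub>1: "grid_system k e A\<^sub>1 B\<^sub>1" "2 * e \<le> card A\<^sub>1"
    "\<And>c. grid_colouring k A\<^sub>1 B\<^sub>1 c \<Longrightarrow> \<exists>p. anchored A\<^sub>1 k c p"
    using ex_anchored_grid_system[OF order_refl] by blast
  obtain A B \<F> where A: "grid_system k e A B" "half_packing e A \<F>"
    and avoiding: "\<And>c. grid_colouring k A B c \<Longrightarrow> \<exists>p. anchored A\<^sub>1 k c p \<and>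
      (\<exists>H\<in>\<F>. \<forall>a\<in>H. \<forall>i<k. c (a, i) \<notin> p ` ({..<k} - {i}))"
    using ex_avoiding_rows[OF A\<^sub>1(1,2) order_refl A\<^sub>1(3), of e] by auto
  have "\<exists>H\<in>\<F>. \<exists>p. rows_coloured_by k H c p" if c: "grid_colouring k A B c" for c
  proof -
    obtain p H where p: "anchored A\<^sub>1 k c p" and H: "H \<in> \<F>"
      and avoids: "\<forall>a\<in>H. \<forall>i<k. c (a, i) \<notin> p ` ({..<k} - {i})"
      using avoiding[OF c] by blast
    have "H \<subseteq> A"
      using A(2) H unfolding half_packing_def by blast
    then have "rows_coloured_by k H c p"
      using p avoids unfolding anchored_def by (intro rows_coloured_by_if_avoiding[OF c]) auto
    then show ?thesis
      using H by blast
  qed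
  then show ?thesis
    using A by blast
qed

lemma ex_grid_system_with_rigid_rows:
  "\<exists>(A :: nat set) B U. grid_system k e A B \<and> U \<subseteq> A \<and> 2 * e \<le> card U \<and> e dvd card U * k \<and>
    rigid_rows k A B U"
proof -
  obtain A :: "nat set" and B \<F> where A: "grid_system k e A B" "half_packing e A \<F>"
    and block: "\<And>c. grid_colouring k A B c \<Longrightarrow> \<exists>H\<in>\<F>. \<exists>p. rows_coloured_by k H c p"
    using ex_grid_system_with_rigid_block by blast
  obtain U C where U: "grid_system k e U C" "U \<inter> A = {}" "2 * e \<le> card U"
    using ex_large_disjoint_grid_system[OF grid_systemD(1)[OF A(1)]] by blast
  obtain D where D: "grid_system k e (A \<union> U) D" "B \<subseteq> D"
    and sees: "\<And>a j H. a \<in> U \<Longrightarrow> j < k \<Longrightarrow> H \<in> \<F> \<Longrightarrow> row_sees k D a j H"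
    using grid_system_attach[OF k e A(1) U(1), of "\<lambda>_ _. \<F>"] U(2) A(2) by (auto simp: Int_commute)
  have "rigid_rows k (A \<union> U) D U"
    unfolding rigid_rows_def
  proof (intro allI impI)
    fix c assume c: "grid_colouring k (A \<union> U) D c"
    obtain H p where "H \<in> \<F>" "rows_coloured_by k H c p"
      using block grid_colouring_subsystem[OF A(1) D(1) _ D(2) c] by blast
    then show "\<exists>p. rows_coloured_by k U c p"
      using rows_coloured_by_if_sees[OF D(1) c, of H p U] sees by blast
  qed
  moreover have "U \<subseteq> A \<union> U"
    by blast
  ultimately show ?thesis
    using D(1) U(3) grid_systemD(3)[OF U(1)] by blast
qed

lemma ex_rigid_grid_system: "\<exists>(A :: nat set) B. grid_system k e A B \<and> A \<noteq> {} \<and> rigid_rows k A B A"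
proof -
  obtain A :: "nat set" and B U where A: "grid_system k e A B" "U \<subseteq> A" "2 * e \<le> card U"
    "e dvd card U * k" "rigid_rows k A B U"
    using ex_grid_system_with_rigid_rows by blast
  obtain W C where W: "grid_system k e W C" "W \<inter> A = {}" "2 * e \<le> card W"
    using ex_large_disjoint_grid_system[OF grid_systemD(1)[OF A(1)]] by blast
  moreover have "W \<noteq> {}"
    using W(3) e by auto
  ultimately show ?thesis
    using ex_rigid_join[OF k e A W(1,3)] by (auto simp: Int_commute)
qed

end

section \<open>Strongly equitable systems as grids\<close>

lemma strongly_equitable_grid: "strongly_equitable k (A \<times> {..<k}) snd"
proof -
  have "colour_class (A \<times> {..<k}) snd i = A \<times> {i}" if "i < k" for i
    using that unfolding colour_class_def by auto
  then show ?thesis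
    unfolding strongly_equitable_def by (simp add: card_cartesian_product)
qed

lemma rigid_grid_system_uniquely_chromatic:
  assumes "grid_system k e A D" "A \<noteq> {}" "rigid_rows k A D A" "k > 0"
  shows "strongly_equitable_uniquely_chromatic k (A \<times> {..<k}) D"
proof -
  note A = grid_systemD[OF assms(1)]
  have uniq: "uniquely_colourable k (A \<times> {..<k}) D"
  proof (rule uniquely_colourableI[where r = snd])
    fix c assume "grid_colouring k A D c"
    then obtain p where "rows_coloured_by k A c p"
      using assms(3) unfolding rigid_rows_def by blast
    then show "\<exists>p. p permutes {..<k} \<and> (\<forall>x\<in>A \<times> {..<k}. c x = p (snd x))"
      unfolding rows_coloured_by_def by auto
  qed
  moreover have "chromatic k (A \<times> {..<k}) D"
    using uniquely_colourable_imp_chromatic[OF A(4) uniq A(5)] assms(2,4) by simp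
  ultimately show ?thesis
    using A(5) strongly_equitable_grid unfolding strongly_equitable_uniquely_chromatic_def by blast
qed

lemma ex_bij_betw_grid:
  assumes "finite V" "c ` V \<subseteq> {..<k}" "\<And>i. i < k \<Longrightarrow> card (colour_class V c i) = m"
  shows "\<exists>f. bij_betw f V ({..<m} \<times> {..<k}) \<and> (\<forall>x\<in>V. snd (f x) = c x)"
proof -
  have "finite (colour_class V c i)" for i
    using assms(1) unfolding colour_class_def by simp
  then have "\<exists>h. bij_betw h (colour_class V c i) {..<m}" if "i < k" for i
    using assms(3)[OF that] by (intro finite_same_card_bij) auto
  then obtain h where h: "\<And>i. i < k \<Longrightarrow> bij_betw (h i) (colour_class V c i) {..<m}"
    by metis
  define f where "f x = (h (c x) x, c x)" for x
  have "inj_on f V"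
  proof (rule inj_onI)
    fix x y assume xy: "x \<in> V" "y \<in> V" "f x = f y"
    then have "inj_on (h (c x)) (colour_class V c (c x))"
      using h assms(2) unfolding bij_betw_def by blast
    then show "x = y"
      using xy unfolding f_def colour_class_def inj_on_def by auto
  qed
  moreover have "f ` V = {..<m} \<times> {..<k}"
  proof -
    have "f ` V = (\<Union>i<k. h i ` colour_class V c i \<times> {i})"
      using assms(2) unfolding f_def colour_class_def by auto
    also have "\<dots> = (\<Union>i<k. {..<m} \<times> {i})"
      using h unfolding bij_betw_def by auto
    finally show ?thesis
      by auto
  qed
  ultimately show ?thesis
    unfolding bij_betw_def f_def by auto
qed

lemma colourable_empty:
  assumes "star_system e n {} B"
  shows "colourable k {} B"
proof -
  have "B = {}"
    using star_system_verts[OF assms] by blast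
  then show ?thesis
    unfolding colourable_def colouring_iff[OF assms] by simp
qed

lemma ex_grid_system_if_strongly_equitable_chromatic:
  assumes sys: "star_system e n V B" and "strongly_equitable_chromatic k V B" "2 * e dvd n" "e > 0"
  shows "\<exists>(A :: nat set) D. grid_system k e A D \<and> A \<noteq> {}"
proof -
  have V: "finite V" "card V = n"
    using sys unfolding star_system_def by auto
  obtain c where c: "colouring k V B c" "strongly_equitable k V c" and "\<not> colourable (k - 1) V B"
    using assms(2) unfolding strongly_equitable_chromatic_def chromatic_def by blast
  then have "V \<noteq> {}"
    using sys colourable_empty by blast
  obtain m where m: "\<And>i. i < k \<Longrightarrow> card (colour_class V c i) = m"
    using c(2) unfolding strongly_equitable_def by metis
  have "c ` V \<subseteq> {..<k}"
    using c(1) unfolding colouring_def by blast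
  then obtain f where f: "bij_betw f V ({..<m} \<times> {..<k})" "\<forall>x\<in>V. snd (f x) = c x"
    using ex_bij_betw_grid[OF V(1) _ m] by blast
  have inj: "inj_on f V" and image: "f ` V = {..<m} \<times> {..<k}"
    using f(1) unfolding bij_betw_def by auto
  have n: "n = m * k"
    using bij_betw_same_card[OF f(1)] V(2) by (simp add: card_cartesian_product)
  have "star_system e n ({..<m} \<times> {..<k}) (map_graph f ` B)"
    using star_system_map_graph[OF sys inj \<open>e > 0\<close>] unfolding image .
  moreover have "grid_colouring k {..<m} (map_graph f ` B) snd"
    using colouring_map_graph[OF sys, of k f snd] colouring_cong[of V "snd \<circ> f" c k B] c(1) f(2)
    unfolding image by simp
  ultimately have "grid_system k e {..<m} (map_graph f ` B)"
    using \<open>2 * e dvd n\<close> unfolding grid_system_def n by simp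
  moreover have "{..<m} \<noteq> {}"
    using image \<open>V \<noteq> {}\<close> by blast
  ultimately show ?thesis
    by blast
qed

theorem theorem4p4:
  fixes k e n\<^sub>0 :: nat
  assumes "k \<ge> 3" and "e \<ge> 3"
    and "[n\<^sub>0 = 0] (mod (2 * e))"
    and "\<exists>(V :: 'a set) B. star_system e n\<^sub>0 V B \<and> strongly_equitable_chromatic k V B"
  shows "\<exists>n. [n = 0] (mod (2 * e)) \<and>
           (\<exists>(V :: nat set) B. star_system e n V B \<and> strongly_equitable_uniquely_chromatic k V B)"
proof -
  obtain V :: "'a set" and B where "star_system e n\<^sub>0 V B" "strongly_equitable_chromatic k V B"
    using assms(4) by blast
  then obtain A\<^sub>0 :: "nat set" and B\<^sub>0 where "grid_system k e A\<^sub>0 B\<^sub>0" "A\<^sub>0 \<noteq> {}"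
    using ex_grid_system_if_strongly_equitable_chromatic assms(2,3) by (fastforce simp: cong_0_iff)
  then interpret grid_base k e A\<^sub>0 B\<^sub>0
    using assms(1,2) by unfold_locales auto
  obtain A :: "nat set" and D where A: "grid_system k e A D" "A \<noteq> {}" "rigid_rows k A D A"
    using ex_rigid_grid_system by blast
  let ?V = "A \<times> {..<k}"
  note sys = grid_systemD(4)[OF A(1)]
  have "strongly_equitable_uniquely_chromatic k ?V D"
    using rigid_grid_system_uniquely_chromatic[OF A] assms(1) by simp
  then have "strongly_equitable_uniquely_chromatic k (prod_encode ` ?V) (map_graph prod_encode ` D)"
    by (rule strongly_equitable_uniquely_chromatic_map_graph[OF sys inj_prod_encode])
  moreover have "star_system e (card A * k) (prod_encode ` ?V) (map_graph prod_encode ` D)"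
    using star_system_map_graph[OF sys inj_prod_encode] assms(2) by simp
  moreover have "[card A * k = 0] (mod (2 * e))"
    using grid_systemD(2)[OF A(1)] by (simp add: cong_0_iff)
  ultimately show ?thesis
    by blast
qed

end
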